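(* Let $q\ge2$ be an integer. Suppose there exists a $Q$-polynomial association scheme with Krein array $\{q^2-1,(q-1)q,1;1,q,q^2-1\}$. If $q>2$, then $q\equiv0$ or $1\pmod 4$.
   Context: For a symmetric association scheme with $D$ classes on a set $X$ with primitive idempotents $E_0=\frac1{|X|}J,E_1,\ldots,E_D$, the Krein parameters $q_{ij}^k$ are defined by $E_i\circ E_j=\frac{1}{|X|}\sum_k q_{ij}^kE_k$ ($\circ$ the entrywise product). The scheme is $Q$-polynomial (with respect to the ordering $E_0,\ldots,E_D$) if the matrix $(q_{1j}^k)_{k,j}$ is tridiagonal with nonzero super- and subdiagonal entries. Its Krein array is $\{b_0^*,\ldots,b_{D-1}^*;c_1^*,\ldots,c_D^*\}$ with $b_i^*=q_{1,i+1}^i$ and $c_i^*=q_{1,i-1}^i$. Here $D=3$. *)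

theory Defs
  imports "HOL-Analysis.Analysis" "HOL-Number_Theory.Cong"
begin

text \<open>The vertex set of a scheme is the universe of a finite type, so that its matrices have type
  \<^typ>\<open>real ^ 'v ^ 'v\<close>. Families indexed by \<open>0, \<dots>, D\<close> are functions on \<^typ>\<open>nat\<close>; their
  values beyond \<open>D\<close> are irrelevant.\<close>

definition symmetric_association_scheme :: "nat \<Rightarrow> (nat \<Rightarrow> ('v::finite) rel) \<Rightarrow> bool" where
  "symmetric_association_scheme D R \<longleftrightarrow>
     R 0 = Id \<and>
     (\<forall>i\<le>D. R i \<noteq> {}) \<and>
     (\<forall>x y. \<exists>!i. i \<le> D \<and> (x, y) \<in> R i) \<and>
     (\<forall>i\<le>D. sym (R i)) \<and>
     (\<exists>p :: nat \<Rightarrow> nat \<Rightarrow> nat \<Rightarrow> nat. \<forall>i\<le>D. \<forall>j\<le>D. \<forall>k\<le>D. \<forall>(x, y) \<in> R k.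
        card {z. (x, z) \<in> R i \<and> (z, y) \<in> R j} = p i j k)"

definition adjacency_matrix :: "('v::finite) rel \<Rightarrow> real ^ 'v ^ 'v" where
  "adjacency_matrix S = (\<chi> x y. if (x, y) \<in> S then 1 else 0)"

definition bose_mesner :: "nat \<Rightarrow> (nat \<Rightarrow> ('v::finite) rel) \<Rightarrow> (real ^ 'v ^ 'v) set" where
  "bose_mesner D R = span ((\<lambda>i. adjacency_matrix (R i)) ` {..D})"

definition idempotent_in :: "(real ^ 'v ^ 'v) set \<Rightarrow> real ^ ('v::finite) ^ 'v \<Rightarrow> bool" where
  "idempotent_in \<A> e \<longleftrightarrow> e \<in> \<A> \<and> e ** e = e"

definition primitive_idempotent_in :: "(real ^ 'v ^ 'v) set \<Rightarrow> real ^ ('v::finite) ^ 'v \<Rightarrow> bool" where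
  "primitive_idempotent_in \<A> e \<longleftrightarrow>
     idempotent_in \<A> e \<and> e \<noteq> 0 \<and>
     (\<forall>f g. idempotent_in \<A> f \<and> idempotent_in \<A> g \<and> f ** g = 0 \<and> g ** f = 0 \<and> e = f + g
        \<longrightarrow> f = 0 \<or> g = 0)"

definition idempotent_ordering ::
    "nat \<Rightarrow> (nat \<Rightarrow> ('v::finite) rel) \<Rightarrow> (nat \<Rightarrow> real ^ 'v ^ 'v) \<Rightarrow> bool" where
  "idempotent_ordering D R E \<longleftrightarrow>
     bij_betw E {..D} {e. primitive_idempotent_in (bose_mesner D R) e} \<and>
     E 0 = (\<chi> x y. 1 / real CARD('v))"

text \<open>\<open>kr i j k\<close> stands for \<open>q\<^sub>i\<^sub>j\<^sup>k\<close>. The product \<open>*\<close> on \<^typ>\<open>real ^ 'v ^ 'v\<close> is the entrywise one.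
  As the primitive idempotents are linearly independent, the equations determine \<open>kr\<close> on
  indices up to \<open>D\<close>.\<close>

definition krein_parameters ::
    "nat \<Rightarrow> (nat \<Rightarrow> real ^ ('v::finite) ^ 'v) \<Rightarrow> (nat \<Rightarrow> nat \<Rightarrow> nat \<Rightarrow> real) \<Rightarrow> bool" where
  "krein_parameters D E kr \<longleftrightarrow>
     (\<forall>i\<le>D. \<forall>j\<le>D. E i * E j = (1 / real CARD('v)) *\<^sub>R (\<Sum>k\<le>D. kr i j k *\<^sub>R E k))"

definition Q_polynomial :: "nat \<Rightarrow> (nat \<Rightarrow> nat \<Rightarrow> nat \<Rightarrow> real) \<Rightarrow> bool" where
  "Q_polynomial D kr \<longleftrightarrow>
     (\<forall>k\<le>D. \<forall>j\<le>D. (k + 1 < j \<or> j + 1 < k \<longrightarrow> kr 1 j k = 0) \<and>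
                     (k + 1 = j \<or> j + 1 = k \<longrightarrow> kr 1 j k \<noteq> 0))"

definition krein_array :: "nat \<Rightarrow> (nat \<Rightarrow> nat \<Rightarrow> nat \<Rightarrow> real) \<Rightarrow> real list \<times> real list" where
  "krein_array D kr =
     (map (\<lambda>i. kr 1 (i + 1) i) [0..<D], map (\<lambda>i. kr 1 (i - 1) i) [1..<D + 1])"

end

theory Submission
  imports Defs
begin

text \<open>The Krein equations determine the entries of the idempotents: \<open>|X| = q\<^sup>3\<close>, the entries of
  \<open>|X| E\<^sub>3\<close> are \<open>q - 1\<close> and \<open>-1\<close>, and those of \<open>|X| E\<^sub>1\<close> are \<open>q\<^sup>2 - 1\<close>, \<open>q - 1\<close>, \<open>-1\<close> and \<open>-q - 1\<close>.
  Since \<open>E\<^sub>0 + E\<^sub>3\<close> is idempotent, the pairs where \<open>|X| E\<^sub>3\<close> has entry \<open>q - 1\<close> form an equivalence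
  relation with \<open>q\<close> classes (fibres) of size \<open>q\<^sup>2\<close>. The vectors that represent a fibre in the
  eigenspace of \<open>E\<^sub>1\<close> form a regular simplex that spans it, so restricting the sum in \<open>E\<^sub>1 E\<^sub>1 = E\<^sub>1\<close> to
  one fibre gives \<open>E\<^sub>1 / q\<close>. As \<open>q > 2\<close>, there are three fibres; for suitable \<open>x\<close> and \<open>y\<close> in two of
  them, exactly \<open>q (q + 3) / 4\<close> vertices \<open>z\<close> of the third have \<open>|X| E\<^sub>1\<close>-entry \<open>q - 1\<close> with both
  \<open>x\<close> and \<open>y\<close>. Hence \<open>4\<close> divides \<open>q (q + 3)\<close>.\<close>


section \<open>Matrix products and orthogonal idempotents\<close>

lemma linear_matrix_mult_right: "linear (\<lambda>B. A ** B)"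
  for A :: "real ^ 'n ^ 'm"
  by (rule linearI)
    (simp_all add: matrix_matrix_mult_def vec_eq_iff sum.distrib distrib_left sum_distrib_left
      mult.left_commute)

lemma linear_matrix_mult_left: "linear (\<lambda>A. A ** B)"
  for B :: "real ^ 'p ^ 'n"
  by (rule linearI)
    (simp_all add: matrix_matrix_mult_def vec_eq_iff sum.distrib distrib_right sum_distrib_left
      mult.assoc)

lemmas matrix_mult_linear_simps =
  linear_diff[OF linear_matrix_mult_right] linear_diff[OF linear_matrix_mult_left]
  linear_scale[OF linear_matrix_mult_right] linear_scale[OF linear_matrix_mult_left]
  linear_0[OF linear_matrix_mult_right] linear_0[OF linear_matrix_mult_left]

text \<open>By symmetry, the trace of \<open>N ** N\<close> is the sum of the squares of the entries
  of \<open>N\<close>.\<close>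

lemma symmetric_idempotent_trace_0:
  fixes N :: "real ^ 'n ^ 'n"
  assumes "transpose N = N" and "N ** N = N" and "trace N = 0"
  shows "N = 0"
proof -
  have sym: "N $ x $ y = N $ y $ x" for x y
    by (metis assms(1) transpose_def vec_lambda_beta)
  have "trace N = trace (N ** N)" using assms(2) by simp
  also have "\<dots> = (\<Sum>x\<in>UNIV. \<Sum>y\<in>UNIV. (N $ x $ y)\<^sup>2)"
    unfolding trace_def matrix_matrix_mult_def vec_lambda_beta power2_eq_square
    by (intro sum.cong refl arg_cong2[where f = "(*)"] sym)
  finally have "(\<Sum>x\<in>UNIV. \<Sum>y\<in>UNIV. (N $ x $ y)\<^sup>2) = 0" using assms(3) by simp
  then show ?thesis
    by (simp add: sum_nonneg_eq_0_iff sum_nonneg vec_eq_iff)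
qed

lemma orthogonal_idempotents_coefficient:
  fixes S :: "(real ^ 'n ^ 'n) set"
  assumes "finite S" and "e \<in> S" and "\<And>e. e \<in> S \<Longrightarrow> e ** e = e"
    and "\<And>e f. e \<in> S \<Longrightarrow> f \<in> S \<Longrightarrow> e \<noteq> f \<Longrightarrow> e ** f = 0"
  shows "e ** (\<Sum>f\<in>S. c f *\<^sub>R f) = c e *\<^sub>R e"
proof -
  have "e ** (\<Sum>f\<in>S. c f *\<^sub>R f) = (\<Sum>f\<in>S. c f *\<^sub>R (e ** f))"
    by (simp add: linear_sum[OF linear_matrix_mult_right] matrix_mult_linear_simps)
  also have "\<dots> = (\<Sum>f\<in>S. if f = e then c e *\<^sub>R e else 0)"
    using assms by (intro sum.cong) auto
  finally show ?thesis using assms(1,2) by simp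
qed

lemma orthogonal_idempotents_independent:
  fixes S :: "(real ^ 'n ^ 'n) set"
  assumes "finite S" and "0 \<notin> S" and "\<And>e. e \<in> S \<Longrightarrow> e ** e = e"
    and "\<And>e f. e \<in> S \<Longrightarrow> f \<in> S \<Longrightarrow> e \<noteq> f \<Longrightarrow> e ** f = 0"
  shows "independent S"
proof (rule independent_if_scalars_zero[OF assms(1)])
  fix c e assume "(\<Sum>f\<in>S. c f *\<^sub>R f) = 0" and "e \<in> S"
  with orthogonal_idempotents_coefficient[OF assms(1) this(2) assms(3,4), of c]
  show "c e = 0" using assms(2) by (auto simp: matrix_mult_linear_simps)
qed

subsection \<open>The Bose-Mesner algebra\<close>

lemma bose_mesner_transpose:
  assumes "symmetric_association_scheme D R" and "M \<in> bose_mesner D R"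
  shows "transpose M = M"
  using assms(2) unfolding bose_mesner_def
proof (induction rule: span_induct_alt)
  case base
  show ?case by (simp add: transpose_def vec_eq_iff)
next
  case (step c B N)
  then obtain i where "i \<le> D" "B = adjacency_matrix (R i)" by auto
  moreover from this have "sym (R i)"
    using assms(1) by (auto simp: symmetric_association_scheme_def)
  ultimately have "transpose B = B"
    by (auto simp: adjacency_matrix_def transpose_def vec_eq_iff dest: symD)
  with step.IH show ?case by (simp add: transpose_def vec_eq_iff)
qed

text \<open>Each entry of the product counts paths of length two, an intersection number that
  depends only on the relation containing \<open>(x, y)\<close>.\<close>

lemma adjacency_matrix_mult_in_bose_mesner:
  fixes R :: "nat \<Rightarrow> ('v::finite) rel"
  assumes "symmetric_association_scheme D R" and "i \<le> D" and "j \<le> D"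
  shows "adjacency_matrix (R i) ** adjacency_matrix (R j) \<in> bose_mesner D R"
proof -
  have "\<exists>p :: nat \<Rightarrow> nat \<Rightarrow> nat \<Rightarrow> nat. \<forall>i\<le>D. \<forall>j\<le>D. \<forall>k\<le>D. \<forall>(x, y) \<in> R k.
      card {z. (x, z) \<in> R i \<and> (z, y) \<in> R j} = p i j k"
    using assms(1) unfolding symmetric_association_scheme_def by (elim conjE)
  then obtain p :: "nat \<Rightarrow> nat \<Rightarrow> nat \<Rightarrow> nat" where
    p0: "\<forall>i\<le>D. \<forall>j\<le>D. \<forall>k\<le>D. \<forall>(x, y) \<in> R k.
      card {z. (x, z) \<in> R i \<and> (z, y) \<in> R j} = p i j k" ..
  have p: "card {z. (x, z) \<in> R i \<and> (z, y) \<in> R j} = p i j k"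
    if "k \<le> D" "(x, y) \<in> R k" for k x y
    using p0[rule_format, OF assms(2,3) that] by simp
  have part: "\<exists>!k. k \<le> D \<and> (x, y) \<in> R k" for x y
    using assms(1) unfolding symmetric_association_scheme_def by (elim conjE allE)
  have "(adjacency_matrix (R i) ** adjacency_matrix (R j)) $ x $ y
      = (\<Sum>k\<le>D. real (p i j k) *\<^sub>R adjacency_matrix (R k)) $ x $ y" for x y
  proof -
    obtain k where k: "k \<le> D" "(x, y) \<in> R k" and
      uniq: "\<And>l. l \<le> D \<Longrightarrow> (x, y) \<in> R l \<Longrightarrow> l = k"
      using part[of x y] by blast
    have entry: "adjacency_matrix (R l) $ x $ y = (if l = k then 1 else 0)" if "l \<le> D" for l
    proof -
      have "(x, y) \<in> R l \<longleftrightarrow> l = k" using k(2) uniq[OF that] by blast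
      then show ?thesis by (simp add: adjacency_matrix_def)
    qed
    have "(adjacency_matrix (R i) ** adjacency_matrix (R j)) $ x $ y
        = (\<Sum>z\<in>UNIV. if (x, z) \<in> R i \<and> (z, y) \<in> R j then 1 else 0)"
      unfolding matrix_matrix_mult_def adjacency_matrix_def by (auto intro!: sum.cong)
    also have "\<dots> = real (p i j k)"
      using p[OF k] by (simp add: sum.If_cases)
    also have "\<dots> = (\<Sum>l\<le>D. if l = k then real (p i j k) else 0)" using k(1) by simp
    also have "\<dots> = (\<Sum>l\<le>D. real (p i j l) *\<^sub>R adjacency_matrix (R l)) $ x $ y"
      unfolding sum_component vector_scaleR_component
      by (intro sum.cong refl) (simp add: entry)
    finally show ?thesis .
  qed
  then have "adjacency_matrix (R i) ** adjacency_matrix (R j)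
      = (\<Sum>k\<le>D. real (p i j k) *\<^sub>R adjacency_matrix (R k))"
    by (simp add: vec_eq_iff)
  also have "\<dots> \<in> bose_mesner D R"
    unfolding bose_mesner_def by (intro span_sum span_mul span_base) auto
  finally show ?thesis .
qed

lemma bose_mesner_mult:
  assumes "symmetric_association_scheme D R"
    and "M \<in> bose_mesner D R" and "N \<in> bose_mesner D R"
  shows "M ** N \<in> bose_mesner D R"
proof -
  note sp = subspace_span[of "(\<lambda>i. adjacency_matrix (R i)) ` {..D}", folded bose_mesner_def]
  have *: "adjacency_matrix (R i) ** N \<in> bose_mesner D R" if "i \<le> D" for i
    using assms(3)
  proof (induction rule: span_induct_alt[of N "(\<lambda>i. adjacency_matrix (R i)) ` {..D}",
        folded bose_mesner_def, consumes 1, case_names base step])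
    case base
    show ?case by (simp add: matrix_mult_linear_simps subspace_0[OF sp])
  next
    case (step c x y)
    then show ?case
      using adjacency_matrix_mult_in_bose_mesner[OF assms(1) that]
      by (auto simp: matrix_add_ldistrib matrix_mult_linear_simps
          intro!: subspace_add[OF sp] subspace_scale[OF sp])
  qed
  show ?thesis
    using assms(2)
  proof (induction rule: span_induct_alt[of M "(\<lambda>i. adjacency_matrix (R i)) ` {..D}",
        folded bose_mesner_def, consumes 1, case_names base step])
    case base
    show ?case by (simp add: matrix_mult_linear_simps subspace_0[OF sp])
  next
    case (step c x y)
    then show ?case using *
      by (auto simp: linear_add[OF linear_matrix_mult_left] matrix_mult_linear_simps
          intro!: subspace_add[OF sp] subspace_scale[OF sp])
  qed
qed

text \<open>Transposing \<open>M ** N\<close> reverses the factors, while both factors and the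
  product are symmetric.\<close>

lemma bose_mesner_commute:
  assumes "symmetric_association_scheme D R"
    and "M \<in> bose_mesner D R" and "N \<in> bose_mesner D R"
  shows "M ** N = N ** M"
  by (metis assms bose_mesner_mult bose_mesner_transpose matrix_transpose_mul)

lemma mat_1_in_bose_mesner:
  assumes "symmetric_association_scheme D R"
  shows "mat 1 \<in> bose_mesner D R"
proof -
  have "mat 1 = adjacency_matrix (R 0)"
    using assms by (simp add: symmetric_association_scheme_def adjacency_matrix_def mat_def vec_eq_iff)
  then show ?thesis unfolding bose_mesner_def by (auto intro: span_base)
qed

section \<open>Primitive idempotents as an orthogonal resolution of the identity\<close>

text \<open>Since \<open>e\<close> splits into the orthogonal idempotents \<open>e ** f\<close> and
  \<open>e - e ** f\<close>, primitivity forces \<open>e ** f\<close> to be \<open>0\<close> or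
  \<open>e\<close>. With the roles exchanged it is \<open>0\<close> or \<open>f\<close>.\<close>

lemma primitive_idempotents_orthogonal:
  assumes "symmetric_association_scheme D R"
    and e: "primitive_idempotent_in (bose_mesner D R) e"
    and f: "primitive_idempotent_in (bose_mesner D R) f" and "e \<noteq> f"
  shows "e ** f = 0"
proof -
  have absorb: "e ** f = 0 \<or> e ** f = e"
    if e: "primitive_idempotent_in (bose_mesner D R) e"
      and f: "primitive_idempotent_in (bose_mesner D R) f" for e f
  proof -
    have mem: "e \<in> bose_mesner D R" "f \<in> bose_mesner D R" and id: "e ** e = e" "f ** f = f"
      using e f by (auto simp: primitive_idempotent_in_def idempotent_in_def)
    note comm = bose_mesner_commute[OF assms(1) mem]
    have ef: "e ** (e ** f) = e ** f" "(e ** f) ** e = e ** f"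
      "(e ** f) ** (e ** f) = e ** f"
      using comm id by (metis matrix_mul_assoc)+
    have "idempotent_in (bose_mesner D R) (e ** f)"
      using bose_mesner_mult[OF assms(1) mem] ef by (simp add: idempotent_in_def)
    moreover have "idempotent_in (bose_mesner D R) (e - e ** f)"
      using bose_mesner_mult[OF assms(1) mem] mem(1) ef id
      by (simp add: idempotent_in_def matrix_mult_linear_simps bose_mesner_def span_diff)
    moreover have "(e ** f) ** (e - e ** f) = 0" "(e - e ** f) ** (e ** f) = 0"
      using ef id by (simp_all add: matrix_mult_linear_simps)
    ultimately show ?thesis
      using e unfolding primitive_idempotent_in_def
      by (metis add.commute diff_add_cancel right_minus_eq)
  qed
  have "e ** f = f ** e"
    using e f by (intro bose_mesner_commute[OF assms(1)])
      (auto simp: primitive_idempotent_in_def idempotent_in_def)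
  then show ?thesis using absorb[OF e f] absorb[OF f e] \<open>e \<noteq> f\<close> by auto
qed

lemma idempotent_ordering_primitive:
  assumes "idempotent_ordering D R E" and "i \<le> D"
  shows "primitive_idempotent_in (bose_mesner D R) (E i)"
  using assms by (auto simp: idempotent_ordering_def bij_betw_def)

lemma idempotent_ordering_nonzero:
  assumes "idempotent_ordering D R E" and "i \<le> D"
  shows "E i \<noteq> 0"
  using idempotent_ordering_primitive[OF assms] unfolding primitive_idempotent_in_def by blast

lemma idempotent_ordering_symmetric:
  assumes "symmetric_association_scheme D R" and "idempotent_ordering D R E" and "i \<le> D"
  shows "E i $ x $ y = E i $ y $ x"
proof -
  have "transpose (E i) = E i"
    using idempotent_ordering_primitive[OF assms(2,3)] bose_mesner_transpose[OF assms(1)]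
    by (simp add: primitive_idempotent_in_def idempotent_in_def)
  then have "transpose (E i) $ x $ y = E i $ x $ y" by simp
  then show ?thesis by (simp add: transpose_def)
qed

lemma idempotent_ordering_mult:
  assumes "symmetric_association_scheme D R" and "idempotent_ordering D R E"
    and "i \<le> D" and "j \<le> D"
  shows "E i ** E j = (if i = j then E i else 0)"
proof (cases "i = j")
  case True
  then show ?thesis using idempotent_ordering_primitive[OF assms(2,3)]
    by (simp add: primitive_idempotent_in_def idempotent_in_def)
next
  case False
  then have "E i \<noteq> E j"
    using assms by (auto simp: idempotent_ordering_def bij_betw_def dest: inj_onD)
  then show ?thesis
    using primitive_idempotents_orthogonal assms idempotent_ordering_primitive False by metis
qed

text \<open>The \<open>D + 1\<close> primitive idempotents are independent in an algebra spanned by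
  \<open>D + 1\<close> matrices, so they span it. Multiplying the expansion of the identity by
  \<open>e\<close> shows that the coefficient of \<open>e\<close> is 1.\<close>

lemma idempotent_ordering_sum:
  assumes "symmetric_association_scheme D R" and "idempotent_ordering D R E"
  shows "(\<Sum>i\<le>D. E i) = mat 1"
proof -
  define S where "S = {e. primitive_idempotent_in (bose_mesner D R) e}"
  have bij: "bij_betw E {..D} S"
    using assms(2) by (simp add: idempotent_ordering_def S_def)
  have fin: "finite S" and card: "card S = D + 1"
    using bij_betw_finite[OF bij] bij_betw_same_card[OF bij] by auto
  have S: "e \<in> bose_mesner D R" "e ** e = e" "e \<noteq> 0" if "e \<in> S" for e
    using that by (auto simp: S_def primitive_idempotent_in_def idempotent_in_def)
  have orth: "e ** f = 0" if "e \<in> S" "f \<in> S" "e \<noteq> f" for e f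
    using primitive_idempotents_orthogonal[OF assms(1)] that by (auto simp: S_def)
  have "independent S"
    using orthogonal_idempotents_independent[OF fin _ S(2) orth] S(3) by auto
  moreover have "dim (bose_mesner D R) \<le> card S"
  proof -
    have "dim (bose_mesner D R) \<le> card ((\<lambda>i. adjacency_matrix (R i)) ` {..D})"
      unfolding bose_mesner_def by (intro dim_le_card) auto
    also have "\<dots> \<le> card {..D}" by (intro card_image_le) simp
    finally show ?thesis by (simp add: card)
  qed
  ultimately have "bose_mesner D R \<subseteq> span S"
    using S(1) by (intro card_ge_dim_independent) auto
  then obtain c where c: "mat 1 = (\<Sum>e\<in>S. c e *\<^sub>R e)"
    using mat_1_in_bose_mesner[OF assms(1)] by (auto simp: span_finite[OF fin])
  have "c e = 1" if "e \<in> S" for e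
  proof -
    have "e = c e *\<^sub>R e"
      using orthogonal_idempotents_coefficient[OF fin that S(2) orth, of c] by (simp flip: c)
    then show ?thesis using S(3)[OF that] by (metis scaleR_cancel_right scaleR_one)
  qed
  then have "mat 1 = (\<Sum>e\<in>S. e)" using c by simp
  then show ?thesis using sum.reindex_bij_betw[OF bij, of "\<lambda>e. e"] by simp
qed

text \<open>As \<open>E 0\<close> is a multiple of the all-ones matrix, row sums can be read off
  from \<open>E i ** E 0\<close>.\<close>

lemma idempotent_ordering_row_sum:
  assumes "symmetric_association_scheme D R" and "idempotent_ordering D R E" and "i \<le> D"
  shows "(\<Sum>y\<in>UNIV. E i $ x $ y) = (if i = 0 then 1 else 0)"
proof -
  have "E 0 = (\<chi> x y. 1 / real CARD('a))" using assms(2) by (simp add: idempotent_ordering_def)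
  moreover have "E i ** E 0 = (if i = 0 then E i else 0)"
    using idempotent_ordering_mult[OF assms, of 0] by simp
  then have "(E i ** E 0) $ x $ x = (if i = 0 then E i $ x $ x else 0)" by simp
  ultimately show ?thesis
    by (auto simp: matrix_matrix_mult_def sum_divide_distrib[symmetric] split: if_splits)
qed

section \<open>General identities for Krein parameters\<close>

text \<open>By symmetry, a diagonal entry of \<open>E i ** E i\<close> is a row sum of the entrywise
  square of \<open>E i\<close>. In the Krein expansion of that square only the term with
  \<open>E 0\<close> contributes to row sums.\<close>

lemma krein_diagonal:
  fixes E :: "nat \<Rightarrow> real ^ ('v::finite) ^ 'v"
  assumes "symmetric_association_scheme D R" and "idempotent_ordering D R E"
    and "krein_parameters D E kr" and "i \<le> D"
  shows "real CARD('v) * E i $ x $ x = kr i i 0"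
proof -
  have "E i $ x $ x = (E i ** E i) $ x $ x"
    using idempotent_ordering_mult[OF assms(1,2,4,4)] by simp
  also have "\<dots> = (\<Sum>y\<in>UNIV. (E i * E i) $ x $ y)"
    unfolding matrix_matrix_mult_def vec_lambda_beta vector_mult_component
    by (intro sum.cong refl arg_cong2[where f = "(*)"]
        idempotent_ordering_symmetric[OF assms(1,2,4)])
  also have "\<dots> = (\<Sum>y\<in>UNIV. \<Sum>k\<le>D. kr i i k * E k $ x $ y / CARD('v))"
    using assms(3,4) by (simp add: krein_parameters_def sum_component sum_divide_distrib)
  also have "\<dots> = (\<Sum>k\<le>D. \<Sum>y\<in>UNIV. kr i i k * E k $ x $ y / CARD('v))"
    by (rule sum.swap)
  also have "\<dots> = (\<Sum>k\<le>D. kr i i k / CARD('v) * (\<Sum>y\<in>UNIV. E k $ x $ y))"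
    by (simp add: sum_distrib_left)
  also have "\<dots> = (\<Sum>k\<le>D. if k = 0 then kr i i 0 / CARD('v) else 0)"
    using idempotent_ordering_row_sum[OF assms(1,2)] by (intro sum.cong) auto
  finally show ?thesis by simp
qed

text \<open>Summing the entrywise products of \<open>E i\<close> with all \<open>E j\<close> leaves
  the diagonal part of \<open>E i\<close>, a scalar matrix by \<open>krein_diagonal\<close>.
  Multiplication by \<open>E k\<close> then compares the coefficients of \<open>E k\<close>.\<close>

lemma krein_row_sum:
  fixes E :: "nat \<Rightarrow> real ^ ('v::finite) ^ 'v"
  assumes "symmetric_association_scheme D R" and "idempotent_ordering D R E"
    and "krein_parameters D E kr" and "i \<le> D" and "k \<le> D"
  shows "(\<Sum>j\<le>D. kr i j k) = kr i i 0"
proof -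
  let ?n = "real CARD('v)"
  have "kr i i 0 *\<^sub>R mat 1 = ?n *\<^sub>R (E i * mat 1)"
    unfolding vec_eq_iff
  proof (intro allI)
    fix x y
    show "(kr i i 0 *\<^sub>R mat 1 :: real ^ 'v ^ 'v) $ x $ y = (?n *\<^sub>R (E i * mat 1)) $ x $ y"
      by (cases "x = y") (simp_all add: mat_def flip: krein_diagonal[OF assms(1-4), of x])
  qed
  also have "\<dots> = (\<Sum>j\<le>D. ?n *\<^sub>R (E i * E j))"
    unfolding idempotent_ordering_sum[OF assms(1,2), symmetric]
    by (simp only: sum_distrib_left scaleR_sum_right)
  also have "\<dots> = (\<Sum>j\<le>D. \<Sum>l\<le>D. kr i j l *\<^sub>R E l)"
    using assms(3,4) by (intro sum.cong) (simp_all add: krein_parameters_def)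
  also have "\<dots> = (\<Sum>l\<le>D. \<Sum>j\<le>D. kr i j l *\<^sub>R E l)"
    by (rule sum.swap)
  finally have eq: "kr i i 0 *\<^sub>R mat 1 = (\<Sum>l\<le>D. (\<Sum>j\<le>D. kr i j l) *\<^sub>R E l)"
    by (simp add: scaleR_sum_left)
  have "kr i i 0 *\<^sub>R E k = E k ** (kr i i 0 *\<^sub>R mat 1)"
    by (simp add: matrix_mult_linear_simps)
  also have "\<dots> = (\<Sum>l\<le>D. (\<Sum>j\<le>D. kr i j l) *\<^sub>R (E k ** E l))"
    unfolding eq by (simp add: linear_sum[OF linear_matrix_mult_right] matrix_mult_linear_simps)
  also have "\<dots> = (\<Sum>l\<le>D. if l = k then (\<Sum>j\<le>D. kr i j k) *\<^sub>R E k else 0)"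
    using idempotent_ordering_mult[OF assms(1,2,5)] by (intro sum.cong) auto
  also have "\<dots> = (\<Sum>j\<le>D. kr i j k) *\<^sub>R E k" using assms(5) by simp
  finally show ?thesis
    using idempotent_ordering_nonzero[OF assms(2,5)] by simp
qed

subsection \<open>Fibres of schemes with the given Krein array\<close>

text \<open>The product \<open>(1 + s z) * (1 + t z)\<close> is 4 where both signs are 1 and 0
  elsewhere; it is expanded and summed over \<open>C\<close>.\<close>

lemma card_common_of_signs:
  fixes q :: int and s t :: "'a \<Rightarrow> real"
  assumes "finite C" and "real (card C) = (real_of_int q)\<^sup>2"
    and "\<And>z. z \<in> C \<Longrightarrow> s z = 1 \<or> s z = -1" and "\<And>z. z \<in> C \<Longrightarrow> t z = 1 \<or> t z = -1"
    and "sum s C = q" and "sum t C = q" and "(\<Sum>z\<in>C. s z * t z) = q"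
  shows "4 * int (card {z \<in> C. s z = 1 \<and> t z = 1}) = q * (q + 3)"
proof -
  have "4 * real (card {z \<in> C. s z = 1 \<and> t z = 1})
      = (\<Sum>z\<in>C. 4 * (if s z = 1 \<and> t z = 1 then 1 else 0))"
    using assms(1) by (simp add: sum.If_cases Int_def flip: sum_distrib_left)
  also have "\<dots> = (\<Sum>z\<in>C. 1 + s z + t z + s z * t z)"
    using assms(3,4) by (intro sum.cong) force+
  also have "\<dots> = real_of_int (q * (q + 3))"
    using assms(2,5-7) by (simp add: sum.distrib power2_eq_square algebra_simps)
  finally show ?thesis by linarith
qed

text \<open>The residues 2 and 3 are excluded because they give 10 and 18, both congruent to
  2.\<close>

lemma mod_4_of_dvd:
  fixes q :: int
  assumes "4 dvd q * (q + 3)"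
  shows "[q = 0] (mod 4) \<or> [q = 1] (mod 4)"
proof -
  have "[q * (q + 3) = (q mod 4) * (q mod 4 + 3)] (mod 4)"
    by (intro cong_mult cong_add) (auto simp: cong_def)
  with assms have "((q mod 4) * (q mod 4 + 3)) mod 4 = 0"
    by (simp add: cong_def mod_eq_0_iff_dvd)
  moreover have "q mod 4 \<in> {0, 1, 2, 3}" by auto
  ultimately show ?thesis by (auto simp: cong_def)
qed

section \<open>The scheme with the given array: entries of its idempotents\<close>

locale krein_array_scheme =
  fixes q :: int
    and R :: "nat \<Rightarrow> ('v::finite) rel"
    and E :: "nat \<Rightarrow> real ^ 'v ^ 'v"
    and kr :: "nat \<Rightarrow> nat \<Rightarrow> nat \<Rightarrow> real"
  assumes q_ge_2: "q \<ge> 2"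
    and scheme: "symmetric_association_scheme 3 R"
    and ordering: "idempotent_ordering 3 R E"
    and krein: "krein_parameters 3 E kr"
    and Q_poly: "Q_polynomial 3 kr"
    and array: "krein_array 3 kr =
           ([(real_of_int q)\<^sup>2 - 1, (real_of_int q - 1) * real_of_int q, 1],
            [1, real_of_int q, (real_of_int q)\<^sup>2 - 1])"
begin

text \<open>Keeps the index 1 from being rewritten to \<open>Suc 0\<close>, so that facts about
  \<open>kr 1\<close> and \<open>E 1\<close> match.\<close>

declare One_nat_def [simp del]

text \<open>These are the dual eigenvalues, the entries of the second eigenmatrix, indexed by a pair
  of vertices instead of its relation.\<close>

abbreviation \<theta> :: "nat \<Rightarrow> 'v \<Rightarrow> 'v \<Rightarrow> real" where
  "\<theta> i x y \<equiv> real CARD('v) * E i $ x $ y"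

lemma q_real: "real_of_int q \<ge> 2"
  using q_ge_2 by linarith

lemma atMost_3: "{..3::nat} = {0, 1, 2, 3}"
  by auto

lemmas E_mult = idempotent_ordering_mult[OF scheme ordering]

lemmas E_symmetric = idempotent_ordering_symmetric[OF scheme ordering]

lemma \<theta>_0: "\<theta> 0 x y = 1"
  using ordering by (simp add: idempotent_ordering_def)

lemma kr_known:
  "kr 1 1 0 = (real_of_int q)\<^sup>2 - 1" "kr 1 2 1 = (real_of_int q - 1) * real_of_int q" "kr 1 3 2 = 1"
  "kr 1 0 1 = 1" "kr 1 1 2 = real_of_int q" "kr 1 2 3 = (real_of_int q)\<^sup>2 - 1"
  using array by (simp_all add: krein_array_def upt_rec One_nat_def numeral_2_eq_2 numeral_3_eq_3)

lemma kr_zero: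
  "kr 1 2 0 = 0" "kr 1 3 0 = 0" "kr 1 3 1 = 0" "kr 1 0 2 = 0" "kr 1 0 3 = 0" "kr 1 1 3 = 0"
  using Q_poly by (simp_all add: Q_polynomial_def)

text \<open>By \<open>krein_row_sum\<close>, the values \<open>kr 1 j k\<close> sum over
  \<open>j\<close> to \<open>kr 1 1 0\<close>; the array and tridiagonality supply all of them
  except the one with \<open>j = k\<close>.\<close>

lemma kr_diagonal:
  "kr 1 1 1 = real_of_int q - 2" "kr 1 2 2 = (real_of_int q)\<^sup>2 - real_of_int q - 2" "kr 1 3 3 = 0"
  using krein_row_sum[OF scheme ordering krein, of 1 1]
    krein_row_sum[OF scheme ordering krein, of 1 2]
    krein_row_sum[OF scheme ordering krein, of 1 3]
  unfolding atMost_3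
  by (simp_all add: kr_known kr_zero power2_eq_square algebra_simps)

lemma \<theta>_mult: "j \<le> 3 \<Longrightarrow> \<theta> 1 x y * \<theta> j x y = (\<Sum>k\<le>3. kr 1 j k * \<theta> k x y)"
proof -
  assume "j \<le> 3"
  then have "E 1 * E j = (1 / real CARD('v)) *\<^sub>R (\<Sum>k\<le>3. kr 1 j k *\<^sub>R E k)"
    using krein by (simp add: krein_parameters_def)
  then have "(E 1 * E j) $ x $ y = ((1 / real CARD('v)) *\<^sub>R (\<Sum>k\<le>3. kr 1 j k *\<^sub>R E k)) $ x $ y"
    by simp
  then show ?thesis
    by (simp add: sum_component sum_distrib_left field_simps)
qed

lemma \<theta>_equations:
  "(\<theta> 1 x y)\<^sup>2 = (real_of_int q)\<^sup>2 - 1 + (real_of_int q - 2) * \<theta> 1 x y + real_of_int q * \<theta> 2 x y"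
  "\<theta> 1 x y * \<theta> 3 x y = \<theta> 2 x y"
  using \<theta>_mult[of 1 x y] \<theta>_mult[of 3 x y] unfolding atMost_3
  by (simp_all add: kr_known kr_zero kr_diagonal \<theta>_0 power2_eq_square)

lemma \<theta>_sum: "1 + \<theta> 1 x y + \<theta> 2 x y + \<theta> 3 x y = (if x = y then real CARD('v) else 0)"
proof -
  have "(\<Sum>i\<le>3. E i) $ x $ y = (if x = y then 1 else 0)"
    by (simp add: idempotent_ordering_sum[OF scheme ordering] mat_def)
  then have "(\<Sum>i\<le>3. \<theta> i x y) = (if x = y then real CARD('v) else 0)"
    by (simp add: sum_component flip: sum_distrib_left)
  then show ?thesis unfolding atMost_3 by (simp add: \<theta>_0)
qed

text \<open>For equal vertices, the first of \<open>\<theta>_equations\<close> yields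
  \<open>\<theta> 2\<close> from \<open>\<theta> 1\<close>, the second yields
  \<open>\<theta> 3\<close>, and \<open>\<theta>_sum\<close> then yields the number of
  vertices.\<close>

lemma \<theta>_diagonal:
  "\<theta> 1 x x = (real_of_int q)\<^sup>2 - 1" "\<theta> 3 x x = real_of_int q - 1"
  and card_vertices: "real CARD('v) = real_of_int q ^ 3"
proof -
  define r where "r = real_of_int q"
  have r: "r \<ge> 2" using q_real by (simp add: r_def)
  show 1: "\<theta> 1 x x = (real_of_int q)\<^sup>2 - 1" for x
    using krein_diagonal[OF scheme ordering krein, of 1 x] by (simp add: kr_known)
  have "r * \<theta> 2 x x = r * ((r\<^sup>2 - 1) * (r - 1))" for x
    using \<theta>_equations(1)[of x x, folded r_def] unfolding 1[of x, folded r_def]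
    by (simp add: power2_eq_square algebra_simps)
  then have 2: "\<theta> 2 x x = (r\<^sup>2 - 1) * (r - 1)" for x using r by simp
  have "r\<^sup>2 - 1 \<noteq> 0" using r by (auto simp: power2_eq_1_iff)
  then show 3: "\<theta> 3 x x = real_of_int q - 1" for x
    using \<theta>_equations(2)[of x x] unfolding 1 2 r_def[symmetric] by simp
  show "real CARD('v) = real_of_int q ^ 3"
    \<comment> \<open>Here \<open>undefined\<close> serves as an arbitrary vertex.\<close>
    using \<theta>_sum[of undefined undefined] unfolding 1 2 3 r_def[symmetric]
    by (simp add: power2_eq_square power3_eq_cube algebra_simps)
qed

text \<open>Putting \<open>\<theta> 2 = \<theta> 1 * \<theta> 3\<close> into the vanishing sum gives
  \<open>(\<theta> 1 + 1) * (\<theta> 3 + 1) = 0\<close>. The quadratic equation for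
  \<open>\<theta> 1\<close> settles each case.\<close>

lemma \<theta>_off_diagonal:
  assumes "x \<noteq> y"
  shows "\<theta> 3 x y = real_of_int q - 1 \<and> \<theta> 1 x y = -1 \<or>
    \<theta> 3 x y = -1 \<and> (\<theta> 1 x y = real_of_int q - 1 \<or> \<theta> 1 x y = - real_of_int q - 1)"
proof -
  define r where "r = real_of_int q"
  define u v w where "u = \<theta> 1 x y" and "v = \<theta> 2 x y" and "w = \<theta> 3 x y"
  have r: "r \<noteq> 0" using q_ge_2 by (simp add: r_def)
  have eq: "u\<^sup>2 = r\<^sup>2 - 1 + (r - 2) * u + r * v" "u * w = v" "1 + u + v + w = 0"
    using \<theta>_equations[of x y] \<theta>_sum[of x y] assms by (simp_all add: r_def u_def v_def w_def)
  have "(u + 1) * (w + 1) = 0" using eq(2,3) by (simp add: algebra_simps)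
  then consider "u = -1" | "w = -1" by force
  then have "w = r - 1 \<and> u = -1 \<or> w = -1 \<and> (u = r - 1 \<or> u = - r - 1)"
  proof cases
    case 1
    then have "v = - w" using eq(3) by simp
    then have "r * w = r * (r - 1)"
      using eq(1) 1 by (simp add: power2_eq_square algebra_simps)
    then show ?thesis using 1 r by simp
  next
    case 2
    then have "v = - u" using eq by simp
    then have "(u - (r - 1)) * (u - (- r - 1)) = 0"
      using eq(1) by (simp add: power2_eq_square algebra_simps)
    then show ?thesis using 2 by (metis mult_eq_0_iff eq_iff_diff_eq_0)
  qed
  then show ?thesis by (simp add: r_def u_def w_def)
qed

section \<open>Fibres as classes of an equivalence relation\<close>

definition fibre :: "'v \<Rightarrow> 'v set" where
  "fibre x = {y. \<theta> 3 x y = real_of_int q - 1}"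

lemma fibre_self: "x \<in> fibre x"
  by (simp add: fibre_def \<theta>_diagonal)

lemma fibre_sym: "y \<in> fibre x \<longleftrightarrow> x \<in> fibre y"
  by (simp add: fibre_def E_symmetric[of 3 x y])

lemma E_0_plus_E_3:
  "(E 0 + E 3) $ x $ y = (if y \<in> fibre x then 1 / (real_of_int q)\<^sup>2 else 0)"
proof -
  have "\<theta> 3 x y = (if y \<in> fibre x then real_of_int q else 0) - 1"
    using \<theta>_off_diagonal[of x y] fibre_self[of x] q_ge_2 by (cases "x = y") (auto simp: fibre_def)
  moreover have "\<theta> 0 x y = 1" by (rule \<theta>_0)
  ultimately have "real CARD('v) * (E 0 + E 3) $ x $ y = (if y \<in> fibre x then real_of_int q else 0)"
    by (simp add: distrib_left)
  also have "\<dots> = real CARD('v) * (if y \<in> fibre x then 1 / (real_of_int q)\<^sup>2 else 0)"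
    using q_ge_2 unfolding card_vertices by (simp add: power2_eq_square power3_eq_cube)
  finally show ?thesis
    by (rule mult_left_cancel[THEN iffD1, rotated]) simp
qed

text \<open>By \<open>E_0_plus_E_3\<close>, the entries of the square of \<open>E 0 + E 3\<close>
  count common vertices of two fibres with weight \<open>1 / q ^ 4\<close>; idempotence compares
  them with entries \<open>1 / q ^ 2\<close> or 0.\<close>

lemma card_common_fibre:
  "real (card {z. z \<in> fibre x \<and> z \<in> fibre y}) = (if y \<in> fibre x then (real_of_int q)\<^sup>2 else 0)"
proof -
  have "(E 0 + E 3) ** (E 0 + E 3) = E 0 + E 3"
    using E_mult
    by (simp add: matrix_add_ldistrib linear_add[OF linear_matrix_mult_left])
  then have "((E 0 + E 3) ** (E 0 + E 3)) $ x $ y = (E 0 + E 3) $ x $ y" by simp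
  then have "(\<Sum>z\<in>UNIV. (if z \<in> fibre x then 1 / (real_of_int q)\<^sup>2 else 0) *
      (if y \<in> fibre z then 1 / (real_of_int q)\<^sup>2 else 0))
      = (if y \<in> fibre x then 1 / (real_of_int q)\<^sup>2 else 0)"
    unfolding matrix_matrix_mult_def vec_lambda_beta E_0_plus_E_3 .
  also have "(\<Sum>z\<in>UNIV. (if z \<in> fibre x then 1 / (real_of_int q)\<^sup>2 else 0) *
      (if y \<in> fibre z then 1 / (real_of_int q)\<^sup>2 else 0))
    = (\<Sum>z\<in>UNIV. (if z \<in> fibre x \<and> z \<in> fibre y then 1 / (real_of_int q)\<^sup>2 / (real_of_int q)\<^sup>2 else 0))"
    using fibre_sym by (intro sum.cong) auto
  also have "\<dots> = real (card {z. z \<in> fibre x \<and> z \<in> fibre y}) / (real_of_int q)\<^sup>2 / (real_of_int q)\<^sup>2"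
    by (simp add: sum.If_cases)
  finally show ?thesis using q_ge_2 by (auto simp: field_simps split: if_splits)
qed

lemma card_fibre: "real (card (fibre x)) = (real_of_int q)\<^sup>2"
  using card_common_fibre[of x x] fibre_self by simp

text \<open>A shared vertex makes the count in \<open>card_common_fibre\<close> nonzero. With
  \<open>fibre_sym\<close> this form gives transitivity.\<close>

lemma fibre_trans:
  assumes "z \<in> fibre x" and "z \<in> fibre y"
  shows "y \<in> fibre x"
proof (rule ccontr)
  assume "y \<notin> fibre x"
  then have "{z. z \<in> fibre x \<and> z \<in> fibre y} = {}" using card_common_fibre[of x y] by simp
  with assms show False by auto
qed

section \<open>The idempotent \<open>E 1\<close> restricted to a fibre\<close>

text \<open>Column \<open>c\<close> of \<open>E 0 + E 3\<close> is a multiple of the indicator of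
  \<open>fibre c\<close>, and \<open>E 1\<close> annihilates it.\<close>

lemma sum_E_1_fibre: "(\<Sum>z\<in>fibre c. E 1 $ x $ z) = 0"
proof -
  have "E 1 ** (E 0 + E 3) = 0"
    using E_mult by (simp add: matrix_add_ldistrib)
  then have "(E 1 ** (E 0 + E 3)) $ x $ c = 0" by simp
  then have "(\<Sum>z\<in>UNIV. E 1 $ x $ z * (if c \<in> fibre z then 1 / (real_of_int q)\<^sup>2 else 0)) = 0"
    unfolding matrix_matrix_mult_def vec_lambda_beta E_0_plus_E_3 .
  also have "(\<Sum>z\<in>UNIV. E 1 $ x $ z * (if c \<in> fibre z then 1 / (real_of_int q)\<^sup>2 else 0))
      = (\<Sum>z\<in>UNIV. if z \<in> fibre c then E 1 $ x $ z / (real_of_int q)\<^sup>2 else 0)"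
    using fibre_sym by (intro sum.cong) auto
  also have "\<dots> = (\<Sum>z\<in>fibre c. E 1 $ x $ z) / (real_of_int q)\<^sup>2"
    by (simp add: sum.If_cases sum_divide_distrib)
  finally show ?thesis using q_ge_2 by simp
qed

text \<open>The block of \<open>E 1\<close> on a fibre is \<open>1 / q\<close> times the projection
  onto the vectors of sum 0, the Gram matrix of a regular simplex.\<close>

lemma E_1_within_fibre:
  assumes "x \<in> fibre c" and "y \<in> fibre c"
  shows "E 1 $ x $ y = (if x = y then 1 / real_of_int q else 0) - 1 / real_of_int q ^ 3"
proof -
  have "y \<in> fibre x" using assms fibre_trans fibre_sym by blast
  then have "\<theta> 1 x y = (if x = y then (real_of_int q)\<^sup>2 else 0) - 1"
    using \<theta>_off_diagonal[of x y] \<theta>_diagonal(1)[of x] q_ge_2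
    by (cases "x = y") (auto simp: fibre_def)
  then show ?thesis
    using q_ge_2 unfolding card_vertices
    by (auto simp: field_simps power2_eq_square power3_eq_cube split: if_splits)
qed

text \<open>The rows of \<open>E 1\<close> indexed by a fibre form a regular simplex with \<open>q\<^sup>2\<close> vertices, which spans
  the row space of \<open>E 1\<close>, as the latter has dimension \<open>q\<^sup>2 - 1\<close>.\<close>

lemma sum_E_1_mult_fibre:
  "(\<Sum>z\<in>fibre c. E 1 $ x $ z * E 1 $ z $ y) = E 1 $ x $ y / real_of_int q"
proof -
  define r where "r = real_of_int q"
  have r: "r \<noteq> 0" using q_ge_2 by (simp add: r_def)
  define C where "C = fibre c"
  \<comment> \<open>\<open>P\<close> restricts to the fibre and \<open>J\<close> is its all-ones
    block; the entries of \<open>B\<close> are the sums in question.\<close>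
  define P :: "real ^ 'v ^ 'v" where "P = (\<chi> x y. if x = y \<and> x \<in> C then 1 else 0)"
  define J :: "real ^ 'v ^ 'v" where "J = (\<chi> x y. if x \<in> C \<and> y \<in> C then 1 else 0)"
  define B where "B = E 1 ** P ** E 1"
  have P_mult: "(P ** M) $ x $ y = (if x \<in> C then M $ x $ y else 0)" for M :: "real^'v^'v" and x y
  proof -
    have "(P ** M) $ x $ y = (\<Sum>z\<in>UNIV. if z = x then (if x \<in> C then M $ x $ y else 0) else 0)"
      unfolding matrix_matrix_mult_def vec_lambda_beta P_def by (intro sum.cong) auto
    then show ?thesis by simp
  qed
  have mult_P: "(M ** P) $ x $ y = (if y \<in> C then M $ x $ y else 0)" for M :: "real^'v^'v" and x y
  proof -
    have "(M ** P) $ x $ y = (\<Sum>z\<in>UNIV. if z = y then (if y \<in> C then M $ x $ y else 0) else 0)"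
      unfolding matrix_matrix_mult_def vec_lambda_beta P_def by (intro sum.cong) auto
    then show ?thesis by simp
  qed
  have B_entry: "B $ x $ y = (\<Sum>z\<in>C. E 1 $ x $ z * E 1 $ z $ y)" for x y
  proof -
    have "B $ x $ y = (\<Sum>z\<in>UNIV. if z \<in> C then E 1 $ x $ z * E 1 $ z $ y else 0)"
      unfolding B_def matrix_matrix_mult_def[of "E 1 ** P"] vec_lambda_beta mult_P
      by (intro sum.cong) auto
    then show ?thesis by (simp add: sum.If_cases)
  qed
  \<comment> \<open>This block appears in the middle of \<open>B ** B\<close>, where
    \<open>E_J\<close> removes its \<open>J\<close> part. Hence \<open>r\<close> times
    \<open>B\<close> is idempotent.\<close>
  have PEP: "P ** E 1 ** P = (1 / r) *\<^sub>R P - (1 / r ^ 3) *\<^sub>R J"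
    using E_1_within_fibre[of _ c, folded C_def r_def]
    by (auto simp: vec_eq_iff mult_P P_mult) (auto simp: P_def J_def)
  have E_J: "E 1 ** J = 0"
  proof -
    have "(E 1 ** J) $ x $ y = (\<Sum>z\<in>UNIV. if z \<in> C then (if y \<in> C then E 1 $ x $ z else 0) else 0)"
      for x y
      unfolding matrix_matrix_mult_def vec_lambda_beta J_def by (intro sum.cong) auto
    then show ?thesis
      using sum_E_1_fibre[of _ c, folded C_def] by (simp add: vec_eq_iff sum.If_cases)
  qed
  have EE: "E 1 ** E 1 = E 1" using E_mult[of 1 1] by simp
  have "B ** B = E 1 ** P ** (E 1 ** E 1) ** P ** E 1"
    by (simp add: B_def matrix_mul_assoc)
  also have "\<dots> = E 1 ** (P ** E 1 ** P) ** E 1"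
    unfolding EE by (simp add: matrix_mul_assoc)
  also have "\<dots> = (1 / r) *\<^sub>R B"
    unfolding PEP by (simp add: B_def matrix_mult_linear_simps E_J)
  finally have BB: "B ** B = (1 / r) *\<^sub>R B" .
  have EB: "E 1 ** B = B" "B ** E 1 = B"
    using EE by (simp_all add: B_def matrix_mul_assoc) (metis matrix_mul_assoc)
  \<comment> \<open>\<open>N\<close> is the part of the projection \<open>E 1\<close> complementary
    to \<open>r\<close> times \<open>B\<close>; equal traces force it to vanish.\<close>
  define N where "N = E 1 - r *\<^sub>R B"
  have "transpose N = N"
    using E_symmetric[of 1]
    by (auto simp: N_def transpose_def vec_eq_iff B_entry mult.commute intro!: sum.cong)
  moreover have "N ** N = N"
    using r by (simp add: N_def matrix_mult_linear_simps EE EB BB)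
  moreover have "trace N = 0"
  proof -
    have diag: "E 1 $ x $ x = (r\<^sup>2 - 1) / r ^ 3" for x
      using \<theta>_diagonal(1)[of x] r unfolding card_vertices r_def[symmetric]
      by (simp add: field_simps)
    \<comment> \<open>Cyclicity of the trace brings the two factors \<open>E 1\<close> together,
      leaving the sum of the diagonal entries of \<open>E 1\<close> over the fibre.\<close>
    have "trace B = trace (P ** E 1)"
      unfolding B_def by (metis trace_mul_sym matrix_mul_assoc EE)
    also have "\<dots> = real (card C) * ((r\<^sup>2 - 1) / r ^ 3)"
      by (simp add: trace_def P_mult sum.If_cases diag)
    also have "\<dots> = (r\<^sup>2 - 1) / r"
      using r card_fibre[of c, folded C_def r_def] by (simp add: power2_eq_square power3_eq_cube)
    finally have "trace B = (r\<^sup>2 - 1) / r" .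
    moreover have "trace (E 1) = r\<^sup>2 - 1"
      using card_vertices[folded r_def] r by (simp add: trace_def diag)
    moreover have "trace (r *\<^sub>R B) = r * trace B"
      by (simp add: trace_def sum_distrib_left)
    ultimately show ?thesis using r by (simp add: N_def trace_sub)
  qed
  ultimately have "N = 0" by (rule symmetric_idempotent_trace_0)
  then have "E 1 $ x $ y = r * B $ x $ y" by (simp add: N_def vec_eq_iff)
  then show ?thesis using r by (simp add: B_entry C_def r_def)
qed

section \<open>Signs between fibres and the final count\<close>

text \<open>An affine rescaling that turns the values \<open>q - 1\<close> and
  \<open>- q - 1\<close> of \<open>\<theta> 1\<close> into 1 and -1. Between two distinct fibres it
  is a regular Hadamard matrix of order \<open>q ^ 2\<close>. Within the fibre of \<open>x\<close>
  it is \<open>q\<close> at \<open>x\<close> and 0 elsewhere.\<close>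

definition sign :: "'v \<Rightarrow> 'v \<Rightarrow> real" where
  "sign x z = (\<theta> 1 x z + 1) / real_of_int q"

lemma sign_cases:
  assumes "z \<notin> fibre x"
  shows "sign x z = 1 \<or> sign x z = -1"
proof -
  have "x \<noteq> z" using assms fibre_self by auto
  with \<theta>_off_diagonal[of x z] assms show ?thesis
    using q_ge_2 by (auto simp: sign_def fibre_def)
qed

lemma E_1_sign: "real_of_int q ^ 3 * E 1 $ x $ z = real_of_int q * sign x z - 1"
  using q_ge_2 unfolding sign_def card_vertices by simp

lemma sum_sign_fibre: "(\<Sum>z\<in>fibre c. sign x z) = q"
proof -
  have "(\<Sum>z\<in>fibre c. sign x z) = (real CARD('v) * (\<Sum>z\<in>fibre c. E 1 $ x $ z) + card (fibre c)) / q"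
    by (simp add: sign_def sum_divide_distrib[symmetric] sum.distrib sum_distrib_left)
  then show ?thesis using q_ge_2 by (simp add: sum_E_1_fibre card_fibre power2_eq_square)
qed

text \<open>This is \<open>sum_E_1_mult_fibre\<close> with the entries of \<open>E 1\<close> written
  through \<open>E_1_sign\<close>; \<open>sum_sign_fibre\<close> evaluates the linear terms.\<close>

lemma sum_sign_mult_fibre: "(\<Sum>z\<in>fibre c. sign x z * sign y z) = \<theta> 1 x y + 1"
proof -
  define r where "r = real_of_int q"
  have r: "r \<noteq> 0" using q_ge_2 by (simp add: r_def)
  have "(\<Sum>z\<in>fibre c. (r * sign x z - 1) * (r * sign y z - 1))
      = r ^ 3 * r ^ 3 * (\<Sum>z\<in>fibre c. E 1 $ x $ z * E 1 $ z $ y)"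
    unfolding r_def E_1_sign[symmetric] sum_distrib_left
  proof (intro sum.cong refl)
    fix z
    have "E 1 $ y $ z = E 1 $ z $ y" by (rule E_symmetric) simp
    then show "real_of_int q ^ 3 * E 1 $ x $ z * (real_of_int q ^ 3 * E 1 $ y $ z)
        = real_of_int q ^ 3 * real_of_int q ^ 3 * (E 1 $ x $ z * E 1 $ z $ y)"
      by simp
  qed
  also have "\<dots> = r\<^sup>2 * \<theta> 1 x y"
    using r unfolding sum_E_1_mult_fibre card_vertices r_def[symmetric]
    by (simp add: power2_eq_square power3_eq_cube)
  also have "(\<Sum>z\<in>fibre c. (r * sign x z - 1) * (r * sign y z - 1))
      = (\<Sum>z\<in>fibre c. r\<^sup>2 * (sign x z * sign y z) - r * sign x z - r * sign y z + 1)"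
    by (intro sum.cong) (simp_all add: algebra_simps power2_eq_square)
  also have "\<dots> = r\<^sup>2 * (\<Sum>z\<in>fibre c. sign x z * sign y z) - r * (\<Sum>z\<in>fibre c. sign x z)
      - r * (\<Sum>z\<in>fibre c. sign y z) + card (fibre c)"
    by (simp add: sum.distrib sum_subtractf sum_distrib_left)
  finally have "r\<^sup>2 * (\<Sum>z\<in>fibre c. sign x z * sign y z) = r\<^sup>2 * (\<theta> 1 x y + 1)"
    unfolding sum_sign_fibre card_fibre r_def[symmetric] by (simp add: power2_eq_square algebra_simps)
  then show ?thesis using r by simp
qed

text \<open>Two fibres cover at most \<open>2 * q ^ 2\<close> vertices, fewer than
  \<open>q ^ 3\<close>.\<close>

lemma ex_three_fibres:
  assumes "q > 2"
  obtains x y c where "y \<notin> fibre x" and "c \<notin> fibre x" and "c \<notin> fibre y"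
proof -
  have large: "2 * (real_of_int q)\<^sup>2 < real CARD('v)"
    unfolding card_vertices using assms by (simp add: power2_eq_square power3_eq_cube)
  have "fibre x \<union> fibre y \<noteq> UNIV" for x y
  proof
    assume "fibre x \<union> fibre y = UNIV"
    then have "CARD('v) \<le> card (fibre x) + card (fibre y)" by (metis card_Un_le)
    with large card_fibre[of x] card_fibre[of y] show False by linarith
  qed
  then show ?thesis using that by (metis UNIV_eq_I Un_iff)
qed

lemma mod_4:
  assumes "q > 2"
  shows "[q = 0] (mod 4) \<or> [q = 1] (mod 4)"
proof -
  obtain x y0 c where fibres: "y0 \<notin> fibre x" "c \<notin> fibre x" "c \<notin> fibre y0"
    using ex_three_fibres[OF assms] .
  have disjoint: "z \<notin> fibre a" if "z \<in> fibre b" "b \<notin> fibre a" for a b z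
    using that fibre_trans by blast
  \<comment> \<open>If every sign were -1, their sum over the fibre could not be the positive number
    \<open>q\<close>.\<close>
  have "\<exists>y\<in>fibre y0. sign x y = 1"
  proof (rule ccontr)
    assume "\<not> (\<exists>y\<in>fibre y0. sign x y = 1)"
    then have "sign x z = -1" if "z \<in> fibre y0" for z
      using that sign_cases disjoint[OF that fibres(1)] by blast
    then have "(\<Sum>z\<in>fibre y0. sign x z) \<le> 0" by (intro sum_nonpos) simp
    then show False using q_ge_2 by (simp add: sum_sign_fibre)
  qed
  then obtain y where y: "y \<in> fibre y0" "sign x y = 1" by blast
  have "c \<notin> fibre y" using y(1) fibres(3) fibre_trans fibre_sym by blast
  then have "sign x z = 1 \<or> sign x z = -1" "sign y z = 1 \<or> sign y z = -1" if "z \<in> fibre c" for z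
    using sign_cases disjoint[OF that] fibres(2) by blast+
  \<comment> \<open>The choice \<open>sign x y = 1\<close> means that
    \<open>\<theta> 1 x y + 1 = q\<close>, so all three sums needed for the count equal
    \<open>q\<close>.\<close>
  moreover have "(\<Sum>z\<in>fibre c. sign x z * sign y z) = q"
    using y(2) q_ge_2 by (simp add: sum_sign_mult_fibre) (simp add: sign_def)
  ultimately have "4 * int (card {z \<in> fibre c. sign x z = 1 \<and> sign y z = 1}) = q * (q + 3)"
    by (intro card_common_of_signs) (simp_all add: card_fibre sum_sign_fibre)
  then show ?thesis by (intro mod_4_of_dvd) (metis dvd_triv_left)
qed

end

theorem theorem3p4:
  fixes q :: int
    and R :: "nat \<Rightarrow> ('v::finite) rel"
    and E :: "nat \<Rightarrow> real ^ 'v ^ 'v"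
    and kr :: "nat \<Rightarrow> nat \<Rightarrow> nat \<Rightarrow> real"
  assumes "q \<ge> 2"
    and "symmetric_association_scheme 3 R"
    and "idempotent_ordering 3 R E"
    and "krein_parameters 3 E kr"
    and "Q_polynomial 3 kr"
    and "krein_array 3 kr =
           ([(real_of_int q)\<^sup>2 - 1, (real_of_int q - 1) * real_of_int q, 1],
            [1, real_of_int q, (real_of_int q)\<^sup>2 - 1])"
    and "q > 2"
  shows "[q = 0] (mod 4) \<or> [q = 1] (mod 4)"
proof -
  interpret krein_array_scheme q R E kr
    using assms by unfold_locales
  show ?thesis using mod_4[OF \<open>q > 2\<close>] .
qed

end
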